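(* For every $\varepsilon > 0$ there exists $\alpha > 0$ such that $c(G) = O(n^{1-\alpha})$ for connected graphs $G$ on $n$ vertices with girth $g \geq 7$ and minimum degree $\delta(G) \geq n^{\varepsilon}$. Explicitly: for every $\varepsilon>0$ there exist $\alpha>0$, $K>0$ and $n_0$ such that every connected graph $G$ on $n \geq n_0$ vertices with girth at least $7$ and minimum degree at least $n^{\varepsilon}$ satisfies $c(G) \leq K n^{1-\alpha}$.
   Context: All graphs are finite, simple, undirected and connected. The girth of a graph is the length of its shortest cycle. The game of cops and robbers on a connected graph $G=(V,E)$ with $k$ cops: the cop player first places $k$ cops on vertices of $G$ (several cops may share a vertex), then the robber player chooses a vertex for the robber. The players then alternate turns, beginning with the cop player. On a turn, a player may move each of their pieces to a vertex adjacent to its current position, or leave that piece where it is (each piece independently). All positions are visible to both players. The cops win if after finitely many moves some cop moves onto the vertex currently occupied by the robber (the robber is captured; a robber who moves onto a vertex occupied by a cop can be captured on the next cop turn). The robber wins if he has a strategy to evade capture indefinitely. The cop number $c(G)$ is the least $k$ such that $k$ cops have a winning strategy on $G$, no matter which vertex the robber begins on and how he plays. *)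

theory Defs
  imports Complex_Main "HOL-Library.Extended_Nat" "Graph_Theory.Graph_Theory"
begin

text \<open>
  Finite simple undirected graphs are the symmetric digraphs of locale \<^locale>\<open>graph\<close>: an
  undirected edge is a pair of opposite arcs, so out-degree is degree. A connected graph
  (\<^const>\<open>Digraph_Component.connected\<close>) has at least one vertex.
\<close>

definition min_degree :: "('a, 'b) pre_digraph \<Rightarrow> nat" where
  "min_degree G = Min (out_degree G ` verts G)"

text \<open>
  The library's notion of cycle admits the closed walk \<open>u, v, u\<close> along an edge and back,
  which is not a cycle of an undirected graph; hence the bound on the length. A forest has
  girth \<open>\<infinity>\<close>.
\<close>

definition girth :: "('a, 'b) pre_digraph \<Rightarrow> enat" where
  "girth G = Inf {enat (length p) | p. pre_digraph.cycle G p \<and> 3 \<le> length p}"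

definition legal_move :: "('a, 'b) pre_digraph \<Rightarrow> 'a \<Rightarrow> 'a \<Rightarrow> bool" where
  "legal_move G u v \<longleftrightarrow> v = u \<or> u \<rightarrow>\<^bsub>G\<^esub> v"

text \<open>
  The robber starts at \<open>r 0\<close>; \<open>r t\<close> is his vertex after his \<open>t\<close>-th move. Plays are infinite
  sequences; what follows a capture is irrelevant.
\<close>

definition robber_play :: "('a, 'b) pre_digraph \<Rightarrow> (nat \<Rightarrow> 'a) \<Rightarrow> bool" where
  "robber_play G r \<longleftrightarrow> r 0 \<in> verts G \<and> (\<forall>t. legal_move G (r t) (r (Suc t)))"

text \<open>
  A cop strategy maps the list of robber vertices seen so far, oldest first, to the positions
  of the cops \<open>0, \<dots>, k - 1\<close>: the empty list to the initial placement, and \<open>[r 0, \<dots>, r t]\<close>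
  to the positions after the cops' reply, their \<open>(t + 1)\<close>-th move. The cops' own earlier moves
  are determined by the strategy, so they need not be recorded.
\<close>

type_synonym 'a cop_strategy = "'a list \<Rightarrow> nat \<Rightarrow> 'a"

definition cops_at :: "'a cop_strategy \<Rightarrow> (nat \<Rightarrow> 'a) \<Rightarrow> nat \<Rightarrow> nat \<Rightarrow> 'a" where
  "cops_at \<sigma> r t = \<sigma> (map r [0..<t])"

definition legal_cop_strategy :: "('a, 'b) pre_digraph \<Rightarrow> nat \<Rightarrow> 'a cop_strategy \<Rightarrow> bool" where
  "legal_cop_strategy G k \<sigma> \<longleftrightarrow>
     (\<forall>i<k. \<sigma> [] i \<in> verts G) \<and>
     (\<forall>r. robber_play G r \<longrightarrow>
        (\<forall>t. \<forall>i<k. legal_move G (cops_at \<sigma> r t i) (cops_at \<sigma> r (Suc t) i)))"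

text \<open>
  When the cops make their \<open>(t + 1)\<close>-th move the robber is still at \<open>r t\<close>. A cop who stays put
  captures a robber who has moved onto his vertex.
\<close>

definition captures :: "nat \<Rightarrow> 'a cop_strategy \<Rightarrow> (nat \<Rightarrow> 'a) \<Rightarrow> bool" where
  "captures k \<sigma> r \<longleftrightarrow> (\<exists>t. \<exists>i<k. cops_at \<sigma> r (Suc t) i = r t)"

definition cops_win :: "('a, 'b) pre_digraph \<Rightarrow> nat \<Rightarrow> bool" where
  "cops_win G k \<longleftrightarrow>
     (\<exists>\<sigma>. legal_cop_strategy G k \<sigma> \<and> (\<forall>r. robber_play G r \<longrightarrow> captures k \<sigma> r))"

definition cop_number :: "('a, 'b) pre_digraph \<Rightarrow> nat" where
  "cop_number G = (LEAST k. cops_win G k)"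

text \<open>On a finite graph the minimum is attained: one cop on each vertex wins.\<close>

lemma cops_win_card_verts:
  assumes "finite (verts G)"
  shows "cops_win G (card (verts G))"
proof -
  obtain f where f: "bij_betw f {0..<card (verts G)} (verts G)"
    using ex_bij_betw_nat_finite[OF assms] by blast
  define \<sigma> where "\<sigma> = (\<lambda>h :: 'a list. f)"
  have "legal_cop_strategy G (card (verts G)) \<sigma>"
    using f by (auto simp: legal_cop_strategy_def \<sigma>_def cops_at_def legal_move_def bij_betw_def)
  moreover have "captures (card (verts G)) \<sigma> r" if "robber_play G r" for r
  proof -
    have "r 0 \<in> f ` {0..<card (verts G)}"
      using that f by (simp add: robber_play_def bij_betw_def)
    then obtain i where "i < card (verts G)" "f i = r 0" by auto
    then show ?thesis by (auto simp: captures_def \<sigma>_def cops_at_def)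
  qed
  ultimately show ?thesis unfolding cops_win_def by blast
qed

end

theory Submission
  imports Defs
begin

text \<open>
  Cops placed on a dominating set win with their first move, so the cop number is at most the
  domination number; and a graph of large minimum degree has a small dominating set. The theorem
  therefore rests on two facts: \<open>cops_win_dominating\<close>, the strategy, and
  \<open>small_dominating_set\<close>, which finds a dominating set of size at most \<open>n / s + n s / d\<close> in a
  graph on \<open>n\<close> vertices of minimum degree at least \<open>d\<close>, for every real \<open>s > 0\<close>. The two terms
  balance at \<open>s = sqrt d\<close>, and with \<open>d = n powr \<epsilon>\<close> this gives the bound
  \<open>2 n powr (1 - \<epsilon> / 2)\<close>, that is \<open>\<alpha> = \<epsilon> / 2\<close> and \<open>K = 2\<close>.
\<close>

text \<open>
  A greedy argument, stated with a maximal set instead of a procedure. Let \<open>D\<close> be as large as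
  possible subject to each of its members paying for \<open>s\<close> dominated vertices, so that
  \<open>card D \<le> n / s\<close>. Then every vertex dominates fewer than \<open>s\<close> of the vertices \<open>U\<close> that \<open>D\<close>
  leaves over. Each vertex of \<open>U\<close> is dominated by at least \<open>d\<close> vertices, so counting the pairs
  twice yields \<open>d * card U \<le> n * s\<close>, and \<open>U\<close> is small enough to be added to \<open>D\<close> wholesale.
\<close>

lemma small_dominating_set:
  fixes V :: "'a set" and R :: "'a \<Rightarrow> 'a \<Rightarrow> bool" and s d :: real
  assumes fin: "finite V" and s: "s > 0" and d: "d > 0"
    and deg: "\<And>u. u \<in> V \<Longrightarrow> d \<le> real (card {v \<in> V. R v u})"
  shows "\<exists>D \<subseteq> V. real (card D) \<le> real (card V) / s + real (card V) * s / d \<and>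
    (\<forall>w \<in> V. \<exists>v \<in> D. v = w \<or> R v w)"
proof -
  define N where "N v = {w \<in> V. R v w}" for v
  define ok where "ok D \<longleftrightarrow> D \<subseteq> V \<and> s * real (card D) \<le> real (card (\<Union>(N ` D)))" for D
  have "ok {}" by (simp add: ok_def)
  moreover have "\<forall>D. ok D \<longrightarrow> card D < Suc (card V)"
    using fin by (auto simp: ok_def less_Suc_eq_le intro: card_mono)
  ultimately have "\<exists>D. ok D \<and> (\<forall>E. ok E \<longrightarrow> card E \<le> card D)"
    by (rule ex_has_greatest_nat)
  then obtain D where D: "ok D" and D_max: "\<And>E. ok E \<Longrightarrow> card E \<le> card D"
    by blast
  have DV: "D \<subseteq> V" using D by (simp add: ok_def)
  have finD: "finite D" using DV fin finite_subset by blast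
  define C where "C = \<Union>(N ` D)"
  define U where "U = V - C"
  have CV: "C \<subseteq> V" by (auto simp: C_def N_def)
  have finC: "finite C" using CV fin by (rule finite_subset)
  have finU: "finite U" using fin by (simp add: U_def)
  have few: "real (card (N v \<inter> U)) \<le> s" if "v \<in> V" for v
  proof (rule ccontr)
    assume many: "\<not> real (card (N v \<inter> U)) \<le> s"
    have "v \<notin> D"
    proof
      assume "v \<in> D"
      then have "N v \<inter> U = {}" by (auto simp: U_def C_def)
      then show False using many s by simp
    qed
    have "card (C \<union> (N v \<inter> U)) = card C + card (N v \<inter> U)"
      by (rule card_Un_disjoint) (use finC finU in \<open>auto simp: U_def\<close>)
    moreover have "\<Union>(N ` insert v D) = C \<union> (N v \<inter> U)"
      by (auto simp: C_def U_def N_def)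
    ultimately have "ok (insert v D)"
      using D many \<open>v \<in> V\<close> \<open>v \<notin> D\<close> finD by (simp add: ok_def C_def algebra_simps)
    then show False using D_max[of "insert v D"] \<open>v \<notin> D\<close> finD by simp
  qed
  have "d * real (card U) = (\<Sum>u\<in>U. d)" by simp
  also have "\<dots> \<le> (\<Sum>u\<in>U. real (card {v \<in> V. R v u}))"
    by (rule sum_mono) (use deg U_def in auto)
  also have "\<dots> = real (\<Sum>u\<in>U. card {v \<in> V. R v u})" by simp
  also have "(\<Sum>u\<in>U. card {v \<in> V. R v u}) = (\<Sum>v\<in>V. card {u \<in> U. R v u})"
    by (rule sum_multicount_gen[symmetric]) (use fin finU in simp_all)
  also have "(\<Sum>v\<in>V. card {u \<in> U. R v u}) = (\<Sum>v\<in>V. card (N v \<inter> U))"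
    by (intro sum.cong arg_cong[where f = card]) (auto simp: N_def U_def)
  also have "real \<dots> = (\<Sum>v\<in>V. real (card (N v \<inter> U)))" by simp
  also have "\<dots> \<le> (\<Sum>v\<in>V. s)" by (rule sum_mono) (rule few)
  also have "\<dots> = real (card V) * s" by simp
  finally have cardU: "real (card U) \<le> real (card V) * s / d"
    using d by (simp add: field_simps)
  have "s * real (card D) \<le> real (card V)"
    using D card_mono[OF fin CV] by (simp add: ok_def C_def)
  then have cardD: "real (card D) \<le> real (card V) / s"
    using s by (simp add: field_simps)
  have "real (card (D \<union> U)) \<le> real (card D) + real (card U)"
    using card_Un_le[of D U] by linarith
  then have "real (card (D \<union> U)) \<le> real (card V) / s + real (card V) * s / d"
    using cardD cardU by linarith
  moreover have "\<forall>w \<in> V. \<exists>v \<in> D \<union> U. v = w \<or> R v w"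
    by (auto simp: U_def C_def N_def)
  ultimately show ?thesis using DV by (intro exI[of _ "D \<union> U"]) (auto simp: U_def)
qed

text \<open>
  Every cop within reach of the robber's starting vertex moves there at once; after that the
  cops stay put, since the play is already decided.
\<close>

lemma cops_win_dominating:
  assumes fin: "finite (verts G)" and DV: "D \<subseteq> verts G"
    and dom: "\<And>w. w \<in> verts G \<Longrightarrow> \<exists>v \<in> D. legal_move G v w"
  shows "cops_win G (card D)"
proof -
  have "finite D" using DV fin finite_subset by blast
  then obtain f where f: "bij_betw f {0..<card D} D"
    using ex_bij_betw_nat_finite by blast
  define \<sigma> where "\<sigma> = (\<lambda>h i. case h of [] \<Rightarrow> f i
    | w # _ \<Rightarrow> if legal_move G (f i) w then w else f i)"
  have start: "cops_at \<sigma> r 0 = f" for r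
    by (simp add: cops_at_def \<sigma>_def)
  have later: "cops_at \<sigma> r (Suc t) i = (if legal_move G (f i) (r 0) then r 0 else f i)" for r t i
    unfolding cops_at_def \<sigma>_def by (simp add: upt_conv_Cons del: upt_Suc)
  have stay: "legal_move G v v" for v by (simp add: legal_move_def)
  have "legal_move G (cops_at \<sigma> r t i) (cops_at \<sigma> r (Suc t) i)" for r t i
    by (cases t) (simp_all add: start later stay)
  moreover have "\<sigma> [] i \<in> verts G" if "i < card D" for i
    using that f DV by (auto simp: \<sigma>_def bij_betw_def)
  ultimately have "legal_cop_strategy G (card D) \<sigma>"
    by (simp add: legal_cop_strategy_def)
  moreover have "captures (card D) \<sigma> r" if play: "robber_play G r" for r
  proof -
    obtain v where "v \<in> D" "legal_move G v (r 0)"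
      using dom play by (auto simp: robber_play_def)
    moreover obtain i where "i < card D" "f i = v"
      using f \<open>v \<in> D\<close> by (force simp: bij_betw_def)
    ultimately have "cops_at \<sigma> r (Suc 0) i = r 0" by (simp add: later)
    then show ?thesis using \<open>i < card D\<close> unfolding captures_def by blast
  qed
  ultimately show ?thesis unfolding cops_win_def by blast
qed

lemma (in graph) min_degree_le_card_neighbours:
  assumes u: "u \<in> verts G"
  shows "min_degree G \<le> card {v \<in> verts G. v \<rightarrow>\<^bsub>G\<^esub> u}"
proof -
  have "inj_on (head G) (out_arcs G u)"
    using no_multi_arcs by (intro inj_onI) (simp add: arc_to_ends_def)
  then have "out_degree G u = card (head G ` out_arcs G u)"
    by (simp add: out_degree_def card_image)
  also have "\<dots> \<le> card {v \<in> verts G. v \<rightarrow>\<^bsub>G\<^esub> u}"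
  proof (rule card_mono)
    have "head G e \<rightarrow>\<^bsub>G\<^esub> u" if "e \<in> out_arcs G u" for e
      by (rule graph_symmetric, rule dominatesI[where a = e]) (use that in \<open>simp_all add: arc_to_ends_def\<close>)
    then show "head G ` out_arcs G u \<subseteq> {v \<in> verts G. v \<rightarrow>\<^bsub>G\<^esub> u}"
      by auto
  qed simp
  finally have "out_degree G u \<le> card {v \<in> verts G. v \<rightarrow>\<^bsub>G\<^esub> u}" .
  moreover have "min_degree G \<le> out_degree G u"
    unfolding min_degree_def using u by simp
  ultimately show ?thesis by linarith
qed

theorem mainTheorem3:
  fixes \<epsilon> :: real
  assumes "\<epsilon> > 0"
  shows "\<exists>\<alpha> > 0. \<exists>K > 0. \<exists>n\<^sub>0 :: nat. \<forall>G :: ('a, 'b) pre_digraph.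
    graph G \<longrightarrow> Digraph_Component.connected G \<longrightarrow> card (verts G) \<ge> n\<^sub>0 \<longrightarrow> girth G \<ge> 7 \<longrightarrow>
    real (min_degree G) \<ge> real (card (verts G)) powr \<epsilon> \<longrightarrow>
    real (cop_number G) \<le> K * real (card (verts G)) powr (1 - \<alpha>)"
proof -
  have "real (cop_number G) \<le> 2 * real (card (verts G)) powr (1 - \<epsilon> / 2)"
    if G: "graph G" and n: "card (verts G) \<ge> 1"
      and deg: "real (min_degree G) \<ge> real (card (verts G)) powr \<epsilon>"
    for G :: "('a, 'b) pre_digraph"
  proof -
    interpret graph G by (rule G)
    define n where "n = real (card (verts G))"
    define s where "s = n powr (\<epsilon> / 2)"
    have pos: "n > 0" "s > 0" "n powr \<epsilon> > 0" using n by (auto simp: n_def s_def)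
    have "n powr \<epsilon> \<le> real (card {v \<in> verts G. v \<rightarrow>\<^bsub>G\<^esub> u})" if "u \<in> verts G" for u
      using min_degree_le_card_neighbours[OF that] deg unfolding n_def by linarith
    then obtain D where D: "D \<subseteq> verts G" "real (card D) \<le> n / s + n * s / n powr \<epsilon>"
      and dom: "\<forall>w \<in> verts G. \<exists>v \<in> D. v = w \<or> v \<rightarrow>\<^bsub>G\<^esub> w"
      using small_dominating_set[of "verts G" s "n powr \<epsilon>" "\<lambda>v u. v \<rightarrow>\<^bsub>G\<^esub> u"] pos
      unfolding n_def by auto
    have "cops_win G (card D)"
      using cops_win_dominating[OF finite_verts D(1)] dom by (metis legal_move_def)
    then have "cop_number G \<le> card D"
      unfolding cop_number_def by (rule Least_le)
    moreover have "n / s = n powr (1 - \<epsilon> / 2)"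
      using pos by (simp add: s_def powr_diff)
    moreover have "n powr \<epsilon> = s * s"
      by (simp add: s_def flip: powr_add)
    then have "n * s / n powr \<epsilon> = n / s" using pos by simp
    ultimately show ?thesis using D(2) by (simp add: n_def)
  qed
  then show ?thesis
    using assms by (intro exI[of _ "\<epsilon> / 2"] exI[of _ 2] exI[of _ 1] conjI) auto
qed

end
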